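(* Let $K$ be a field, $S=K[x_1,\ldots,x_n]$, let $I\subset S$ be a squarefree strongly stable principal ideal, and let $A$ be a subset of $[n]=\{1,\ldots,n\}$. Then the monomial localization $I(P_A)$ is a squarefree strongly stable principal ideal in the polynomial ring $S_A=K[x_i : i\in[n]\setminus A]$.
   Context: For a monomial ideal $I$, $G(I)$ denotes its unique minimal set of monomial generators. Let $T=K[x_i : i\in N]$ be a polynomial ring whose variables are indexed by a finite set $N$ of positive integers. A monomial ideal $I\subset T$ generated in a single degree is squarefree strongly stable if all $u\in G(I)$ are squarefree and, for every $u\in G(I)$ and all $i<j$ in $N$ such that $x_j\mid u$ and $x_i\nmid u$, one has $x_i(u/x_j)\in G(I)$. It is a squarefree strongly stable principal ideal if there is a squarefree monomial $u\in G(I)$ (called the Borel generator) such that $I$ is the smallest squarefree strongly stable ideal of $T$ containing $u$; then one writes $B_1(u)=G(I)$. Explicitly, if $u=x_{i_1}\cdots x_{i_d}$ with $i_1<\cdots<i_d$ in $N$, then $B_1(u)=\{x_{j_1}\cdots x_{j_d} : j_1<\cdots<j_d \text{ in } N,\ j_k\le i_k \text{ for } 1\le k\le d\}$. The case $u=1$ (degree $0$), i.e. the unit ideal, is allowed. For $A\subset[n]$ let $P_A$ be the monomial prime ideal of $S$ generated by $\{x_i : i\notin A\}$, and let $S_A=K[x_i : i\in [n]\setminus A]$ (variables keep their indices and order). For a monomial ideal $I\subset S$, the monomial localization $I(P_A)$ is the unique monomial ideal of $S_A$ with $I(P_A)S_{P_A}=IS_{P_A}$; equivalently, it is the ideal of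 $S_A$ obtained by substituting $x_i\mapsto 1$ for all $i\in A$ in the generators of $I$. *)

theory Defs
  imports
    "HOL-Library.Poly_Mapping"
    "HOL-Computational_Algebra.Fraction_Field"
    "HOL-Algebra.Ideal"
begin

text \<open>
  Monomials are represented by their exponent vectors of type \<open>nat \<Rightarrow>\<^sub>0 nat\<close>, and
  polynomials by finitely supported families of coefficients indexed by monomials. All
  polynomial rings \<open>K[x\<^sub>i : i \<in> N]\<close> are subrings of this one type, cut out by
  their carriers; in this way \<open>S\<^sub>A\<close> is literally a subring of \<open>S\<close>. As a
  multiplicative monoid, the monomials are written additively.
\<close>

type_synonym mono = "nat \<Rightarrow>\<^sub>0 nat"
type_synonym 'k mpoly = "mono \<Rightarrow>\<^sub>0 'k"

definition mono_poly :: "mono \<Rightarrow> 'k::field mpoly"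
  where "mono_poly u = Poly_Mapping.single u 1"

definition var :: "nat \<Rightarrow> 'k::field mpoly"
  where "var i = mono_poly (Poly_Mapping.single i 1)"

definition monomials_in :: "nat set \<Rightarrow> mono set"
  where "monomials_in N = {u. Poly_Mapping.keys u \<subseteq> N}"

definition poly_ring :: "nat set \<Rightarrow> 'k::field mpoly ring"
  where "poly_ring N =
    \<lparr>carrier = {p. Poly_Mapping.keys p \<subseteq> monomials_in N},
     mult = (*), one = 1, zero = 0, add = (+)\<rparr>"

definition mono_deg :: "mono \<Rightarrow> nat"
  where "mono_deg u = (\<Sum>i\<in>Poly_Mapping.keys u. Poly_Mapping.lookup u i)"

definition squarefree_mono :: "mono \<Rightarrow> bool"
  where "squarefree_mono u \<longleftrightarrow> (\<forall>i. Poly_Mapping.lookup u i \<le> 1)"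

definition generated_by_monos :: "nat set \<Rightarrow> mono set \<Rightarrow> 'k::field mpoly set \<Rightarrow> bool"
  where "generated_by_monos N U I \<longleftrightarrow>
    U \<subseteq> monomials_in N \<and> I = Idl\<^bsub>poly_ring N\<^esub> (mono_poly ` U)"

definition monomial_ideal :: "nat set \<Rightarrow> 'k::field mpoly set \<Rightarrow> bool"
  where "monomial_ideal N I \<longleftrightarrow>
    ideal I (poly_ring N) \<and> (\<exists>U. generated_by_monos N U I)"

text \<open>The set \<open>G(I)\<close>; it is a well-defined set whenever \<open>I\<close> is a monomial ideal.\<close>

definition min_gens :: "nat set \<Rightarrow> 'k::field mpoly set \<Rightarrow> mono set"
  where "min_gens N I =
    (THE G. generated_by_monos N G I \<and> (\<forall>H. H \<subset> G \<longrightarrow> \<not> generated_by_monos N H I))"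

definition generated_in_single_degree :: "nat set \<Rightarrow> 'k::field mpoly set \<Rightarrow> bool"
  where "generated_in_single_degree N I \<longleftrightarrow> (\<exists>d. \<forall>u\<in>min_gens N I. mono_deg u = d)"

text \<open>
  The exponent vector of \<open>x\<^sub>i (u / x\<^sub>j)\<close> is
  \<open>single i 1 + (u - single j 1)\<close>; the pointwise truncated subtraction is exact here,
  since \<open>x\<^sub>j\<close> divides \<open>u\<close>.
\<close>

definition squarefree_strongly_stable :: "nat set \<Rightarrow> 'k::field mpoly set \<Rightarrow> bool"
  where "squarefree_strongly_stable N I \<longleftrightarrow>
    monomial_ideal N I \<and>
    generated_in_single_degree N I \<and>
    (\<forall>u\<in>min_gens N I. squarefree_mono u) \<and>
    (\<forall>u\<in>min_gens N I. \<forall>i\<in>N. \<forall>j\<in>N.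
       i < j \<and> j \<in> Poly_Mapping.keys u \<and> i \<notin> Poly_Mapping.keys u \<longrightarrow>
       Poly_Mapping.single i 1 + (u - Poly_Mapping.single j 1) \<in> min_gens N I)"

definition borel_generator :: "nat set \<Rightarrow> mono \<Rightarrow> 'k::field mpoly set \<Rightarrow> bool"
  where "borel_generator N u I \<longleftrightarrow>
    u \<in> min_gens N I \<and> squarefree_mono u \<and>
    squarefree_strongly_stable N I \<and> mono_poly u \<in> I \<and>
    (\<forall>J. squarefree_strongly_stable N J \<and> mono_poly u \<in> J \<longrightarrow> I \<subseteq> J)"

definition squarefree_strongly_stable_principal :: "nat set \<Rightarrow> 'k::field mpoly set \<Rightarrow> bool"
  where "squarefree_strongly_stable_principal N I \<longleftrightarrow> (\<exists>u. borel_generator N u I)"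

text \<open>In the following definitions \<open>S = K[x\<^sub>1, \<dots>, x\<^sub>n]\<close> is \<open>poly_ring {1..n}\<close>.\<close>

definition mono_prime :: "nat \<Rightarrow> nat set \<Rightarrow> 'k::field mpoly set"
  where "mono_prime n A = Idl\<^bsub>poly_ring {1..n}\<^esub> (var ` ({1..n} - A))"

text \<open>
  The localization of \<open>S\<close> at \<open>P\<^sub>A\<close>, as a subring of the field of fractions of
  the ambient polynomial ring in all variables (which contains the field of fractions of
  \<open>S\<close>), and the extension to it of an ideal of \<open>S\<close> or of \<open>S\<^sub>A\<close>.
\<close>

definition local_ring :: "nat \<Rightarrow> nat set \<Rightarrow> 'k::field mpoly fract ring"
  where "local_ring n A =
    \<lparr>carrier = {Fract f g | f g. f \<in> carrier (poly_ring {1..n}) \<and>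
                                g \<in> carrier (poly_ring {1..n}) - mono_prime n A},
     mult = (*), one = 1, zero = 0, add = (+)\<rparr>"

definition local_extension :: "nat \<Rightarrow> nat set \<Rightarrow> 'k::field mpoly set \<Rightarrow> 'k mpoly fract set"
  where "local_extension n A I = Idl\<^bsub>local_ring n A\<^esub> ((\<lambda>f. Fract f 1) ` I)"

definition monomial_localization :: "nat \<Rightarrow> nat set \<Rightarrow> 'k::field mpoly set \<Rightarrow> 'k mpoly set"
  where "monomial_localization n A I =
    (THE J. monomial_ideal ({1..n} - A) J \<and> local_extension n A J = local_extension n A I)"

end

theory Submission
  imports Defs
begin

text \<open>
  A squarefree monomial with support \<open>W\<close> lies in the principal ideal with Borel generator
  of support \<open>U\<close> if and only if \<open>\<bar>U \<inter> [1,t]\<bar> \<le> \<bar>W \<inter> [1,t]\<bar>\<close> for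
  all \<open>t\<close>. Localizing at \<open>P\<^sub>A\<close> replaces this condition on
  \<open>W\<close> by the same condition on \<open>W \<union> A\<close>. For a single variable \<open>a\<close>, the
  condition on \<open>W \<union> {a}\<close> for \<open>U\<close> is the condition on \<open>W\<close> for \<open>U\<close>
  without its least element \<open>b \<ge> a\<close> (nothing is removed if there is none), so by iteration
  the localization has a Borel generator again.
\<close>

subsection \<open>Prefix counts of finite sets\<close>

text \<open>Prefix counts replace the componentwise comparison j_k <= i_k because localization can
  lower degrees: supports of different sizes have to be compared, and for equal sizes the two
  conditions agree. The variables of A become units, so x_W lies in the localization as soon as x_W
  times some monomial in these variables lies in I. Since I has squarefree generators, exponents
  above one do not help, and the product of all variables of A is the best multiplier; hence
  \<open>W \<union> A\<close> is the right set to test. The final support may be empty, and then the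
  localization is the unit ideal.

  The remaining work comes from two indirect definitions. A Borel generator is characterized by
  minimality among all stable ideals, including those generated in a lower degree, and
  \<open>monomial_localization\<close> is a definite description over ideals with equal extensions
  in a ring of fractions. Exchanging indices resolves the first; the second requires that a monomial
  ideal of S_A can be read off from its extension.\<close>

definition count_le :: "nat set \<Rightarrow> nat set \<Rightarrow> bool"
  where "count_le U W \<longleftrightarrow> (\<forall>t. card (U \<inter> {..t}) \<le> card (W \<inter> {..t}))"

lemma count_le_refl [simp]: "count_le U U"
  by (simp add: count_le_def)

lemma count_le_trans: "count_le U V \<Longrightarrow> count_le V W \<Longrightarrow> count_le U W"
  unfolding count_le_def by (meson order_trans)

lemma count_le_superset: "finite W \<Longrightarrow> U \<subseteq> W \<Longrightarrow> count_le U W"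
  unfolding count_le_def by (auto intro!: card_mono)

lemma count_le_card:
  assumes "count_le U W" "finite U" "finite W"
  shows "card U \<le> card W"
proof -
  obtain t where t: "\<forall>x\<in>U \<union> W. x \<le> t"
    using assms finite_nat_set_iff_bounded_le[of "U \<union> W"] by auto
  hence "U \<inter> {..t} = U" "W \<inter> {..t} = W" by auto
  with assms(1)[unfolded count_le_def, rule_format, of t] show ?thesis by simp
qed

lemma card_Diff_singleton_atMost:
  "card ((U - {b :: nat}) \<inter> {..t}) = card (U \<inter> {..t}) - (if b \<in> U \<and> b \<le> t then 1 else 0)"
proof -
  have "(U - {b}) \<inter> {..t} = (if b \<in> U \<and> b \<le> t then U \<inter> {..t} - {b} else U \<inter> {..t})"
    by auto
  thus ?thesis by simp
qed

lemma card_insert_atMost: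
  assumes "(a :: nat) \<notin> U"
  shows "card (insert a U \<inter> {..t}) = card (U \<inter> {..t}) + (if a \<le> t then 1 else 0)"
proof -
  have "finite (U \<inter> {..t})" by (rule finite_Int) simp
  thus ?thesis using assms by (simp add: Int_insert_left)
qed

lemma card_exchange: "finite V \<Longrightarrow> j \<in> V \<Longrightarrow> i \<notin> V \<Longrightarrow> card (insert i (V - {j})) = card V"
  using card_Suc_Diff1[of V j] by simp

text \<open>As long as W has more elements than U, its maximum can be deleted: prefixes that end
  before it do not change, and a prefix that contains it contains all of W, so at least
  \<open>card U\<close> elements remain.\<close>

lemma count_le_subset_same_card:
  assumes "finite W" "finite U" "count_le U W"
  shows "\<exists>V\<subseteq>W. card V = card U \<and> count_le U V"
  using assms
proof (induction "card W - card U" arbitrary: W)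
  case 0
  then show ?case using count_le_card[of U W] by (metis diff_is_0_eq le_antisym subset_refl)
next
  case (Suc k)
  define m where "m = Max W"
  have "card U < card W" using Suc.hyps(2) by simp
  hence "W \<noteq> {}" by auto
  hence m: "m \<in> W" "\<And>x. x \<in> W \<Longrightarrow> x \<le> m" using Suc.prems by (auto simp: m_def)
  have "count_le U (W - {m})"
    unfolding count_le_def
  proof
    fix t
    show "card (U \<inter> {..t}) \<le> card ((W - {m}) \<inter> {..t})"
    proof (cases "m \<le> t")
      case True
      hence "W \<inter> {..t} = W" using m by force
      moreover have "card (U \<inter> {..t}) \<le> card U" using Suc.prems by (intro card_mono) auto
      ultimately show ?thesis using True m \<open>card U < card W\<close>
        by (simp add: card_Diff_singleton_atMost)
    next
      case False
      thus ?thesis using Suc.prems(3) by (simp add: card_Diff_singleton_atMost count_le_def)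
    qed
  qed
  moreover have "k = card (W - {m}) - card U" using Suc.hyps(2) m Suc.prems by simp
  ultimately obtain V where "V \<subseteq> W - {m}" "card V = card U" "count_le U V"
    using Suc.hyps(1) Suc.prems by (metis finite_Diff)
  thus ?case by blast
qed

text \<open>With b the least element of U such that a <= b, the witness is \<open>U - {b}\<close>.
  Prefixes that end before a see neither a nor b, and for prefixes that reach b both counts shift by
  one. If a <= t < b, then U has no element in [a,t], so the bound that holds just before a, where
  the inserted a cannot help, carries over to t. If there is no b, this last argument covers every t
  >= a, and U itself is the witness.\<close>

lemma count_le_insert_iff:
  shows "\<exists>V\<subseteq>U - {a}. \<forall>W. finite W \<longrightarrow> a \<notin> W \<longrightarrow> count_le U (insert a W) \<longleftrightarrow> count_le V W"
proof (cases "\<exists>b\<in>U. a \<le> b")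
  case False
  have "count_le U (insert a W) \<longleftrightarrow> count_le U W" if W: "finite W" "a \<notin> W" for W
  proof
    assume *: "count_le U (insert a W)"
    show "count_le U W"
      unfolding count_le_def
    proof
      fix t
      show "card (U \<inter> {..t}) \<le> card (W \<inter> {..t})"
      proof (cases "a \<le> t")
        case True
        show ?thesis
        \<comment> \<open>The comparison uses the prefix that ends at a - 1. It does not exist for a
          = 0, but then U is empty because it has no element >= a.\<close>
        proof (cases a)
          case 0
          thus ?thesis using False by simp
        next
          case (Suc s)
          have "U \<inter> {..t} = U \<inter> {..s}" using False True Suc by (auto simp: not_le)
          moreover have "card (U \<inter> {..s}) \<le> card (W \<inter> {..s})"
            using *[unfolded count_le_def, rule_format, of s] card_insert_atMost[OF W(2), of s] Suc
            by simp
          moreover have "card (W \<inter> {..s}) \<le> card (W \<inter> {..t})"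
            using W True Suc by (intro card_mono) auto
          ultimately show ?thesis by simp
        qed
      next
        case False
        thus ?thesis using *[unfolded count_le_def, rule_format, of t] card_insert_atMost[OF W(2), of t] by simp
      qed
    qed
  next
    assume "count_le U W"
    thus "count_le U (insert a W)"
      using count_le_trans count_le_superset W by (metis finite_insert subset_insertI)
  qed
  thus ?thesis using False by (intro exI[of _ U]) auto
next
  case True
  define b where "b = (LEAST b. b \<in> U \<and> a \<le> b)"
  have b: "b \<in> U" "a \<le> b" and least: "\<And>c. c \<in> U \<Longrightarrow> a \<le> c \<Longrightarrow> b \<le> c"
    using LeastI_ex[of "\<lambda>b. b \<in> U \<and> a \<le> b"] True unfolding b_def by (auto intro: Least_le)
  have "count_le U (insert a W) \<longleftrightarrow> count_le (U - {b}) W" if W: "finite W" "a \<notin> W" for W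
  proof
    assume *: "count_le U (insert a W)"
    show "count_le (U - {b}) W"
      unfolding count_le_def
    proof
      fix t
      have t: "card (U \<inter> {..t}) \<le> card (W \<inter> {..t}) + (if a \<le> t then 1 else 0)"
        using *[unfolded count_le_def, rule_format, of t] card_insert_atMost[OF W(2), of t] by simp
      show "card ((U - {b}) \<inter> {..t}) \<le> card (W \<inter> {..t})"
      proof (cases "a \<le> t \<and> t < b")
        case True
        show ?thesis
        proof (cases a)
          case 0
          hence "U \<inter> {..t} = {}" using least True by force
          thus ?thesis using True by (simp add: card_Diff_singleton_atMost)
        next
          case (Suc s)
          have "U \<inter> {..t} = U \<inter> {..s}"
            using True Suc least by (auto; metis leD le_less_trans not_less_eq_eq)
          moreover have "card (U \<inter> {..s}) \<le> card (W \<inter> {..s})"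
            using *[unfolded count_le_def, rule_format, of s] card_insert_atMost[OF W(2), of s] Suc
            by simp
          moreover have "card (W \<inter> {..s}) \<le> card (W \<inter> {..t})"
            using W True Suc by (intro card_mono) auto
          ultimately show ?thesis by (simp add: card_Diff_singleton_atMost)
        qed
      next
        case False
        thus ?thesis using t b by (auto simp: card_Diff_singleton_atMost split: if_splits)
      qed
    qed
  next
    assume *: "count_le (U - {b}) W"
    show "count_le U (insert a W)"
      unfolding count_le_def
    proof
      fix t
      have "card (U \<inter> {..t}) - (if b \<le> t then 1 else 0) \<le> card (W \<inter> {..t})"
        using *[unfolded count_le_def, rule_format, of t] card_Diff_singleton_atMost[of U b t] b by auto
      thus "card (U \<inter> {..t}) \<le> card (insert a W \<inter> {..t})"
        using b W by (auto simp: card_insert_atMost split: if_splits)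
    qed
  qed
  moreover have "U - {b} \<subseteq> U - {a}" using b least by force
  ultimately show ?thesis by blast
qed

text \<open>The witness is chosen before W. This order of quantifiers lets the induction hypothesis
  for A be used at \<open>insert a W\<close>, after which only the single element a has to be
  absorbed.\<close>

lemma count_le_union_iff:
  assumes "finite A"
  shows "\<exists>V\<subseteq>U - A. \<forall>W. finite W \<longrightarrow> W \<inter> A = {} \<longrightarrow> count_le U (W \<union> A) \<longleftrightarrow> count_le V W"
  using assms
proof (induction A)
  case empty
  show ?case by (intro exI[of _ U]) auto
next
  case (insert a A)
  then obtain V where V: "V \<subseteq> U - A"
    "\<And>W. finite W \<Longrightarrow> W \<inter> A = {} \<Longrightarrow> count_le U (W \<union> A) \<longleftrightarrow> count_le V W" by blast
  from count_le_insert_iff[of V a] obtain V' where V': "V' \<subseteq> V - {a}"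
    "\<And>W. finite W \<Longrightarrow> a \<notin> W \<Longrightarrow> count_le V (insert a W) \<longleftrightarrow> count_le V' W" by blast
  have "count_le U (W \<union> insert a A) \<longleftrightarrow> count_le V' W" if "finite W" "W \<inter> insert a A = {}" for W
  proof -
    have "count_le U (insert a W \<union> A) \<longleftrightarrow> count_le V (insert a W)"
      using that insert.hyps by (intro V(2)) auto
    also have "\<dots> \<longleftrightarrow> count_le V' W" using that by (intro V'(2)) auto
    finally show ?thesis by simp
  qed
  moreover have "V' \<subseteq> U - insert a A" using V(1) V'(1) by blast
  ultimately show ?case by blast
qed

text \<open>These are the supports of the monomials in B_1(u) for u with support U: for sets of
  equal size, \<open>count_le U V\<close> says that the k-th smallest element of V is at most that
  of U, for every k.\<close>

definition borel_set :: "nat set \<Rightarrow> nat set \<Rightarrow> nat set set"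
  where "borel_set N U = {V. V \<subseteq> N \<and> finite V \<and> card V = card U \<and> count_le U V}"

text \<open>Moving an element of V to a smaller index can only increase the prefix counts.\<close>

lemma borel_set_exchange:
  assumes "V \<in> borel_set N U" "i < j" "i \<in> N" "j \<in> V" "i \<notin> V"
  shows "insert i (V - {j}) \<in> borel_set N U"
proof -
  have V: "V \<subseteq> N" "finite V" "card V = card U" "count_le U V"
    using assms(1) by (auto simp: borel_set_def)
  have "card (V \<inter> {..t}) \<le> card (insert i (V - {j}) \<inter> {..t})" for t
  proof -
    \<comment> \<open>Positivity makes the truncated subtraction of 1 exact, so that for j <= t the
      loss of j is balanced by the gain of i.\<close>
    have "card (V \<inter> {..t}) > 0" if "j \<le> t"
      using that assms V by (auto simp: card_gt_0_iff)
    thus ?thesis using assms V by (simp add: card_insert_atMost card_Diff_singleton_atMost)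
  qed
  hence "count_le U (insert i (V - {j}))"
    using V(4) count_le_trans unfolding count_le_def by (meson order_trans)
  moreover have "card (insert i (V - {j})) = card U"
    using V assms card_exchange[of V j i] by metis
  ultimately show ?thesis using V assms by (auto simp: borel_set_def)
qed

text \<open>U is moved towards V by exchanges that stay in G. The smallest j in U but not in V is
  traded for some smaller i in V but not in U, which shrinks \<open>U - V\<close>. Taking the
  smallest j is what preserves the prefix condition: below j all of U lies in V, so V has a surplus
  at every t with i <= t < j.\<close>

lemma borel_set_subset_stable:
  assumes stable: "\<And>W i j. W \<in> G \<Longrightarrow> i < j \<Longrightarrow> i \<in> N \<Longrightarrow> j \<in> W \<Longrightarrow> i \<notin> W \<Longrightarrow> insert i (W - {j}) \<in> G"
    and "U \<in> G" "finite U"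
  shows "borel_set N U \<subseteq> G"
proof
  fix V assume "V \<in> borel_set N U"
  hence V: "V \<subseteq> N" "finite V" "card V = card U" "count_le U V" by (auto simp: borel_set_def)
  show "V \<in> G"
    using assms(2,3) V(3,4)
  proof (induction "card (U - V)" arbitrary: U)
    case 0
    hence "U \<subseteq> V" by simp
    thus ?case using 0 V by (metis card_subset_eq)
  next
    case (Suc k)
    define j where "j = Min (U - V)"
    have "U - V \<noteq> {}" using Suc.hyps(2) by force
    hence j: "j \<in> U" "j \<notin> V" "\<And>x. x \<in> U \<Longrightarrow> x < j \<Longrightarrow> x \<in> V"
      using Suc.prems Min_in[of "U - V"] Min_le[of "U - V"] unfolding j_def by fastforce+
    have "\<exists>i\<in>V - U. i < j"
    \<comment> \<open>Without such an i, the set V up to j would be contained in U up to j and miss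
      j itself, against the prefix condition at t = j.\<close>
    proof (rule ccontr)
      assume "\<not> ?thesis"
      hence "V \<inter> {..j} \<subseteq> U \<inter> {..j}" using j by (auto simp: not_less) (metis DiffI le_antisym)
      hence "V \<inter> {..j} \<subset> U \<inter> {..j}" using j by auto
      hence "card (V \<inter> {..j}) < card (U \<inter> {..j})" using Suc.prems by (intro psubset_card_mono) auto
      thus False using Suc.prems(4) by (meson count_le_def leD)
    qed
    then obtain i where i: "i \<in> V" "i \<notin> U" "i < j" by blast
    define U' where "U' = insert i (U - {j})"
    have "U' - V = (U - V) - {j}" using i by (auto simp: U'_def)
    hence "k = card (U' - V)" using Suc.hyps(2) Suc.prems j by simp
    moreover have "U' \<in> G" using stable[of U i j] Suc.prems i j V by (auto simp: U'_def)
    moreover have "finite U'" "card V = card U'"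
      using Suc.prems i j card_exchange[of U j i] unfolding U'_def by (blast, metis)
    moreover have "count_le U' V"
      unfolding count_le_def
    proof
      fix t
      have t: "card (U \<inter> {..t}) \<le> card (V \<inter> {..t})" using Suc.prems(4) by (simp add: count_le_def)
      have *: "card (U' \<inter> {..t}) = card (U \<inter> {..t}) - (if j \<le> t then 1 else 0) + (if i \<le> t then 1 else 0)"
        using i j by (simp add: U'_def card_insert_atMost card_Diff_singleton_atMost)
      show "card (U' \<inter> {..t}) \<le> card (V \<inter> {..t})"
      proof (cases "i \<le> t")
        case True
        show ?thesis
        proof (cases "j \<le> t")
          case False
          hence "U \<inter> {..t} \<subset> V \<inter> {..t}" using j i True by auto
          hence "card (U \<inter> {..t}) < card (V \<inter> {..t})" using V by (intro psubset_card_mono) auto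
          thus ?thesis using * True False by simp
        next
          case T: True
          hence "card (U \<inter> {..t}) > 0" using j Suc.prems by (auto simp: card_gt_0_iff)
          thus ?thesis using * True T t by simp
        qed
      next
        case False
        thus ?thesis using * t i by simp
      qed
    qed
    ultimately show ?case by (intro Suc.hyps(1))
  qed
qed

text \<open>This turns the numerical condition into divisibility: a squarefree monomial that meets
  it is a multiple of a monomial from B_1(u).\<close>

lemma count_le_borel_set:
  assumes "finite W" "finite U" "W \<subseteq> N" "count_le U W"
  shows "\<exists>V\<in>borel_set N U. V \<subseteq> W"
proof -
  obtain V where "V \<subseteq> W" "card V = card U" "count_le U V"
    using count_le_subset_same_card assms by meson
  thus ?thesis using assms by (intro bexI[of _ V]) (auto simp: borel_set_def finite_subset)
qed

subsection \<open>Monomial ideals\<close>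

abbreviation ring_on :: "'a::comm_ring_1 set \<Rightarrow> 'a ring"
  where "ring_on C \<equiv> \<lparr>carrier = C, mult = (*), one = 1, zero = 0, add = (+)\<rparr>"

text \<open>Both \<open>poly_ring\<close> and \<open>local_ring\<close> have this shape inside an
  ambient commutative ring, so their ring axioms reduce to closure properties.\<close>

lemma ring_of_closed:
  fixes C :: "'a::comm_ring_1 set"
  assumes "0 \<in> C" "1 \<in> C" "\<And>x. x \<in> C \<Longrightarrow> - x \<in> C"
    and "\<And>x y. x \<in> C \<Longrightarrow> y \<in> C \<Longrightarrow> x + y \<in> C"
    and "\<And>x y. x \<in> C \<Longrightarrow> y \<in> C \<Longrightarrow> x * y \<in> C"
  shows "ring (ring_on C)"
proof (rule ringI)
  show "abelian_group (ring_on C)"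
    by (rule abelian_groupI) (use assms in \<open>auto simp: algebra_simps intro!: bexI[of _ "- _"]\<close>)
  show "monoid (ring_on C)"
    by (rule monoidI) (use assms in \<open>auto simp: algebra_simps\<close>)
qed (auto simp: algebra_simps)

lemma ideal_of_closed:
  fixes C :: "'a::comm_ring_1 set"
  assumes ring: "ring (ring_on C)"
    and "I \<subseteq> C" "0 \<in> I" "\<And>x y. x \<in> I \<Longrightarrow> y \<in> I \<Longrightarrow> x + y \<in> I"
    and mult: "\<And>x y. x \<in> I \<Longrightarrow> y \<in> C \<Longrightarrow> y * x \<in> I"
  shows "ideal I (ring_on C)"
proof (rule idealI[OF ring])
  interpret ring "ring_on C" by fact
  have neg: "\<ominus>\<^bsub>ring_on C\<^esub> x = - x" if "x \<in> C" for x
    using l_neg[of x] that by (simp add: eq_neg_iff_add_eq_0)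
  have "\<ominus>\<^bsub>ring_on C\<^esub> \<one>\<^bsub>ring_on C\<^esub> \<in> carrier (ring_on C)"
    by (rule a_inv_closed) (rule one_closed)
  \<comment> \<open>Negatives of elements of I arise by multiplying with -1, so closure of I under
    negation need not be assumed.\<close>
  hence m1: "- 1 \<in> C" using neg[of 1] one_closed by simp
  show "subgroup I (add_monoid (ring_on C))"
  proof (rule add.subgroupI)
    fix x assume "x \<in> I"
    thus "\<ominus>\<^bsub>ring_on C\<^esub> x \<in> I" using mult[OF _ m1, of x] neg[of x] assms(2) by auto
  qed (use assms in auto)
qed (use mult in \<open>auto simp: mult.commute\<close>)

lemma keys_add_nat: "Poly_Mapping.keys (u + v :: mono) = Poly_Mapping.keys u \<union> Poly_Mapping.keys v"
  by (auto simp: in_keys_iff lookup_add)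

lemma monomials_in_add [simp]: "u + v \<in> monomials_in N \<longleftrightarrow> u \<in> monomials_in N \<and> v \<in> monomials_in N"
  by (auto simp: monomials_in_def keys_add_nat)

lemma zero_monomials_in [simp]: "0 \<in> monomials_in N"
  by (simp add: monomials_in_def)

lemma keys_mono_poly [simp]: "Poly_Mapping.keys (mono_poly u :: 'k::field mpoly) = {u}"
  by (simp add: mono_poly_def)

lemma mono_poly_add: "mono_poly (u + v) = mono_poly u * mono_poly v"
  by (simp add: mono_poly_def mult_single)

lemma mono_poly_nonzero [simp]: "mono_poly u \<noteq> (0 :: 'k::field mpoly)"
  using keys_mono_poly[of u] by (metis insert_not_empty keys_zero)

lemma keys_uminus: "Poly_Mapping.keys (- p :: 'a \<Rightarrow>\<^sub>0 'b::ab_group_add) = Poly_Mapping.keys p"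
  by (auto simp: in_keys_iff)

lemma poly_ring_simps [simp]:
  "mult (poly_ring N) = (*)" "one (poly_ring N) = 1"
  "zero (poly_ring N) = 0" "add (poly_ring N) = (+)"
  by (simp_all add: poly_ring_def)

lemma carrier_poly_ring: "p \<in> carrier (poly_ring N) \<longleftrightarrow> Poly_Mapping.keys p \<subseteq> monomials_in N"
  by (simp add: poly_ring_def)

lemma ring_poly_ring: "ring (poly_ring N :: 'k::field mpoly ring)"
  unfolding poly_ring_def
proof (rule ring_of_closed)
  fix p q :: "'k mpoly"
  assume p: "p \<in> {p. Poly_Mapping.keys p \<subseteq> monomials_in N}"
    and q: "q \<in> {p. Poly_Mapping.keys p \<subseteq> monomials_in N}"
  show "p + q \<in> {p. Poly_Mapping.keys p \<subseteq> monomials_in N}"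
    using p q keys_add[of p q] by auto
  show "p * q \<in> {p. Poly_Mapping.keys p \<subseteq> monomials_in N}"
    using p q keys_mult[of p q] by fastforce
qed (auto simp: keys_uminus)

lemma poly_ring_closed:
  fixes N :: "nat set"
  shows "0 \<in> carrier (poly_ring N)" "1 \<in> carrier (poly_ring N)"
    and "p \<in> carrier (poly_ring N) \<Longrightarrow> q \<in> carrier (poly_ring N) \<Longrightarrow> p + q \<in> carrier (poly_ring N)"
    and "p \<in> carrier (poly_ring N) \<Longrightarrow> q \<in> carrier (poly_ring N) \<Longrightarrow> p * q \<in> carrier (poly_ring N)"
    and "p \<in> carrier (poly_ring N) \<Longrightarrow> - p \<in> carrier (poly_ring N)"
proof -
  interpret ring "poly_ring N" by (rule ring_poly_ring)
  show "0 \<in> carrier (poly_ring N)" "1 \<in> carrier (poly_ring N)"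
    using zero_closed one_closed by simp_all
  show "p \<in> carrier (poly_ring N) \<Longrightarrow> q \<in> carrier (poly_ring N) \<Longrightarrow> p + q \<in> carrier (poly_ring N)"
    using a_closed[of p q] by simp
  show "p \<in> carrier (poly_ring N) \<Longrightarrow> q \<in> carrier (poly_ring N) \<Longrightarrow> p * q \<in> carrier (poly_ring N)"
    using m_closed[of p q] by simp
qed (simp add: carrier_poly_ring keys_uminus)

lemma poly_mapping_sum_single:
  "p = (\<Sum>k\<in>Poly_Mapping.keys p. Poly_Mapping.single k (Poly_Mapping.lookup p k))"
  by (rule poly_mapping_eqI) (auto simp: lookup_sum lookup_single when_def in_keys_iff)

lemma sum_closed:
  assumes "0 \<in> D" "\<And>x y. x \<in> D \<Longrightarrow> y \<in> D \<Longrightarrow> x + y \<in> D" "\<And>k. k \<in> X \<Longrightarrow> f k \<in> D"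
  shows "sum f X \<in> D"
  using assms by (induction X rule: infinite_finite_induct) auto

lemma poly_mapping_closed:
  fixes p :: "'a \<Rightarrow>\<^sub>0 'b::comm_monoid_add"
  assumes "0 \<in> D" "\<And>x y. x \<in> D \<Longrightarrow> y \<in> D \<Longrightarrow> x + y \<in> D"
    and "\<And>k c. k \<in> Poly_Mapping.keys p \<Longrightarrow> Poly_Mapping.single k c \<in> D"
  shows "p \<in> D"
proof -
  have "(\<Sum>k\<in>Poly_Mapping.keys p. Poly_Mapping.single k (Poly_Mapping.lookup p k)) \<in> D"
    using assms by (intro sum_closed) auto
  thus ?thesis by (simp flip: poly_mapping_sum_single)
qed

section \<open>Ideals spanned by monomials\<close>

definition multiples :: "nat set \<Rightarrow> mono set \<Rightarrow> mono set"
  where "multiples N U = {u + w | u w. u \<in> U \<and> w \<in> monomials_in N}"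

text \<open>This is the closed form of the ideal generated by the monomials in U, for U inside the
  ring. It tests membership on each term separately and so avoids sums of products of
  generators.\<close>

definition mono_ideal :: "nat set \<Rightarrow> mono set \<Rightarrow> 'k::field mpoly set"
  where "mono_ideal N U = {p. Poly_Mapping.keys p \<subseteq> multiples N U}"

lemma multiples_self: "u \<in> U \<Longrightarrow> u \<in> multiples N U"
  unfolding multiples_def by (force intro: exI[of _ "0 :: mono"])

lemma multiples_add: "m \<in> multiples N U \<Longrightarrow> w \<in> monomials_in N \<Longrightarrow> m + w \<in> multiples N U"
proof -
  assume "m \<in> multiples N U" and w: "w \<in> monomials_in N"
  then obtain u v where "m + w = u + (v + w)" "u \<in> U" "v \<in> monomials_in N"
    by (auto simp: multiples_def add.assoc)
  thus ?thesis using w unfolding multiples_def using monomials_in_add by blast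
qed

lemma multiples_subset_monomials_in: "U \<subseteq> monomials_in N \<Longrightarrow> multiples N U \<subseteq> monomials_in N"
  by (auto simp: multiples_def)

lemma multiples_mono: "U \<subseteq> multiples N V \<Longrightarrow> multiples N U \<subseteq> multiples N V"
  using multiples_add[of _ N V] unfolding multiples_def[of N U] by blast

lemma mono_ideal_mono: "U \<subseteq> multiples N V \<Longrightarrow> mono_ideal N U \<subseteq> mono_ideal N V"
  using multiples_mono[of U N V] by (auto simp: mono_ideal_def)

lemma mono_poly_mem_mono_ideal_iff [simp]: "mono_poly m \<in> mono_ideal N U \<longleftrightarrow> m \<in> multiples N U"
  by (simp add: mono_ideal_def)

lemma mono_ideal_0 [simp]: "0 \<in> mono_ideal N U"
  by (simp add: mono_ideal_def)

lemma mono_ideal_add: "p \<in> mono_ideal N U \<Longrightarrow> q \<in> mono_ideal N U \<Longrightarrow> p + q \<in> mono_ideal N U"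
  using keys_add[of p q] by (auto simp: mono_ideal_def)

lemma mono_ideal_mult:
  assumes "p \<in> mono_ideal N U" "q \<in> carrier (poly_ring N)"
  shows "q * p \<in> mono_ideal N U"
proof -
  have "Poly_Mapping.keys (q * p) \<subseteq> multiples N U"
  proof
    fix k assume "k \<in> Poly_Mapping.keys (q * p)"
    then obtain a b where ab: "k = b + a" "a \<in> Poly_Mapping.keys q" "b \<in> Poly_Mapping.keys p"
      using keys_mult[of q p] by (auto simp: add.commute)
    thus "k \<in> multiples N U"
      using assms multiples_add[of b N U a] by (auto simp: mono_ideal_def poly_ring_def)
  qed
  thus ?thesis by (simp add: mono_ideal_def)
qed

lemma ideal_mono_ideal:
  assumes "U \<subseteq> monomials_in N"
  shows "ideal (mono_ideal N U) (poly_ring N :: 'k::field mpoly ring)"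
  unfolding poly_ring_def
proof (rule ideal_of_closed)
  show "ring \<lparr>carrier = {p :: 'k mpoly. Poly_Mapping.keys p \<subseteq> monomials_in N},
      mult = (*), one = 1, zero = 0, add = (+)\<rparr>"
    using ring_poly_ring[of N] by (simp add: poly_ring_def)
  show "mono_ideal N U \<subseteq> {p. Poly_Mapping.keys p \<subseteq> monomials_in N}"
    using multiples_subset_monomials_in[OF assms] by (auto simp: mono_ideal_def)
qed (use mono_ideal_mult in \<open>auto simp: mono_ideal_add poly_ring_def\<close>)

lemma Idl_mono_poly:
  assumes "U \<subseteq> monomials_in N"
  shows "Idl\<^bsub>poly_ring N\<^esub> (mono_poly ` U :: 'k::field mpoly set) = mono_ideal N U"
proof
  interpret ring "poly_ring N :: 'k mpoly ring" by (rule ring_poly_ring)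
  show "Idl\<^bsub>poly_ring N\<^esub> (mono_poly ` U :: 'k mpoly set) \<subseteq> mono_ideal N U"
    by (intro genideal_minimal ideal_mono_ideal assms) (auto intro: multiples_self)
  have U: "mono_poly ` U \<subseteq> carrier (poly_ring N :: 'k mpoly ring)"
    using assms by (auto simp: poly_ring_def)
  interpret I: ideal "Idl\<^bsub>poly_ring N\<^esub> (mono_poly ` U :: 'k mpoly set)" "poly_ring N"
    by (rule genideal_ideal[OF U])
  show "mono_ideal N U \<subseteq> Idl\<^bsub>poly_ring N\<^esub> (mono_poly ` U :: 'k mpoly set)"
  proof
    fix p :: "'k mpoly" assume p: "p \<in> mono_ideal N U"
    show "p \<in> Idl\<^bsub>poly_ring N\<^esub> (mono_poly ` U)"
    proof (rule poly_mapping_closed)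
      show "0 \<in> Idl\<^bsub>poly_ring N\<^esub> (mono_poly ` U :: 'k mpoly set)"
        using I.zero_closed by simp
      show "x + y \<in> Idl\<^bsub>poly_ring N\<^esub> (mono_poly ` U)"
        if "x \<in> Idl\<^bsub>poly_ring N\<^esub> (mono_poly ` U)" "y \<in> Idl\<^bsub>poly_ring N\<^esub> (mono_poly ` U)"
        for x y :: "'k mpoly"
        using I.a_closed[OF that] by simp
    next
      fix k and c :: 'k assume "k \<in> Poly_Mapping.keys p"
      then obtain u w where k: "k = u + w" "u \<in> U" "w \<in> monomials_in N"
        using p by (auto simp: mono_ideal_def multiples_def)
      have "mono_poly u \<in> Idl\<^bsub>poly_ring N\<^esub> (mono_poly ` U :: 'k mpoly set)"
        using genideal_self[OF U] k by auto
      moreover have "Poly_Mapping.single w c \<in> carrier (poly_ring N)"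
        using k by (simp add: carrier_poly_ring)
      ultimately have "mono_poly u * Poly_Mapping.single w c \<in> Idl\<^bsub>poly_ring N\<^esub> (mono_poly ` U)"
        using I.I_r_closed by fastforce
      thus "Poly_Mapping.single k c \<in> Idl\<^bsub>poly_ring N\<^esub> (mono_poly ` U)"
        by (simp add: mono_poly_def mult_single k)
    qed
  qed
qed

lemma generated_by_monos_iff:
  "generated_by_monos N U I \<longleftrightarrow> U \<subseteq> monomials_in N \<and> I = mono_ideal N U"
  by (auto simp: generated_by_monos_def Idl_mono_poly)

lemma monomial_ideal_iff:
  "monomial_ideal N I \<longleftrightarrow> (\<exists>U\<subseteq>monomials_in N. I = mono_ideal N U)"
  by (auto simp: monomial_ideal_def generated_by_monos_iff intro: ideal_mono_ideal)

section \<open>Existence and uniqueness of the minimal generators\<close>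

definition antichain :: "mono set \<Rightarrow> bool"
  where "antichain G \<longleftrightarrow> (\<forall>g\<in>G. \<forall>h\<in>G. \<forall>w. g = h + w \<longrightarrow> w = 0)"

text \<open>If H generates the same ideal, each g in G is a multiple of some h in H, and h is a
  multiple of some g' in G. The antichain condition makes both cofactors trivial, so g = h. Thus G
  lies in every generating set of monomials, which settles the definite description in
  \<open>min_gens\<close>.\<close>

lemma min_gens_mono_ideal:
  assumes G: "G \<subseteq> monomials_in N" "antichain G"
  shows "min_gens N (mono_ideal N G :: 'k::field mpoly set) = G"
proof -
  have sub: "G \<subseteq> H" if H: "H \<subseteq> monomials_in N" "mono_ideal N G = (mono_ideal N H :: 'k mpoly set)" for H
  proof
    fix g assume g: "g \<in> G"
    hence "(mono_poly g :: 'k mpoly) \<in> mono_ideal N G" by (auto intro: multiples_self)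
    hence "g \<in> multiples N H" by (simp add: H)
    then obtain h w where h: "g = h + w" "h \<in> H" by (auto simp: multiples_def)
    hence "(mono_poly h :: 'k mpoly) \<in> mono_ideal N H" by (auto intro: multiples_self)
    hence "h \<in> multiples N G" by (simp flip: H(2))
    then obtain g' w' where g': "h = g' + w'" "g' \<in> G" by (auto simp: multiples_def)
    have "w' + w = 0" using G(2) g g' h unfolding antichain_def by (metis add.assoc)
    \<comment> \<open>Exponents are natural numbers, so a sum of two exponent vectors vanishes only
      if both do.\<close>
    hence "Poly_Mapping.keys w' \<union> Poly_Mapping.keys w = {}" by (simp flip: keys_add_nat)
    hence "w = 0" by (intro poly_mapping_eqI) (auto simp: in_keys_iff)
    thus "g \<in> H" using h by simp
  qed
  show ?thesis
    unfolding min_gens_def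
  proof (rule the_equality)
    show "generated_by_monos N G (mono_ideal N G) \<and>
        (\<forall>H. H \<subset> G \<longrightarrow> \<not> generated_by_monos N H (mono_ideal N G :: 'k mpoly set))"
      using sub G(1) unfolding generated_by_monos_iff by blast
    fix H assume H: "generated_by_monos N H (mono_ideal N G :: 'k mpoly set) \<and>
        (\<forall>H'. H' \<subset> H \<longrightarrow> \<not> generated_by_monos N H' (mono_ideal N G :: 'k mpoly set))"
    hence "G \<subseteq> H" by (intro sub) (simp_all add: generated_by_monos_iff)
    moreover have "generated_by_monos N G (mono_ideal N G :: 'k mpoly set)"
      using G(1) by (simp add: generated_by_monos_iff)
    ultimately show "H = G" using H by (metis psubsetI)
  qed
qed

lemma mono_deg_add: "mono_deg (u + v) = mono_deg u + mono_deg v"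
  unfolding mono_deg_def by (rule setsum_keys_plus_distrib) auto

lemma mono_deg_eq_0_iff: "mono_deg u = 0 \<longleftrightarrow> u = 0"
  by (auto simp: mono_deg_def in_keys_iff intro: poly_mapping_eqI)

text \<open>From an arbitrary, possibly infinite, generating set, the elements with no proper
  divisor in the set still generate: passing to a proper divisor lowers the degree, so the descent
  stops. Hence \<open>min_gens\<close> denotes a generating set for every monomial ideal.\<close>

lemma monomial_ideal_obtain_min_gens:
  assumes "monomial_ideal N (I :: 'k::field mpoly set)"
  shows "min_gens N I \<subseteq> monomials_in N" "I = mono_ideal N (min_gens N I)"
proof -
  from assms obtain U where U: "U \<subseteq> monomials_in N" "I = mono_ideal N U"
    by (auto simp: monomial_ideal_iff)
  define G where "G = {g \<in> U. \<forall>h\<in>U. \<forall>w. g = h + w \<longrightarrow> w = 0}"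
  have "u \<in> multiples N G" if "u \<in> U" for u
    using that
  proof (induction "mono_deg u" arbitrary: u rule: less_induct)
    case less
    show ?case
    proof (cases "u \<in> G")
      case True
      thus ?thesis by (rule multiples_self)
    next
      case False
      then obtain h w where h: "h \<in> U" "u = h + w" "w \<noteq> 0" using less.prems by (auto simp: G_def)
      hence "mono_deg h < mono_deg u" using mono_deg_eq_0_iff[of w] by (simp add: mono_deg_add)
      hence "h \<in> multiples N G" using less h by blast
      moreover have "w \<in> monomials_in N" using U less.prems h by auto
      ultimately show ?thesis using h multiples_add by blast
    qed
  qed
  hence I: "I = mono_ideal N G"
    using U mono_ideal_mono[of U N G] mono_ideal_mono[of G N U]
    by (auto simp: G_def subset_eq intro: multiples_self)
  have G: "G \<subseteq> monomials_in N" "antichain G" using U by (auto simp: G_def antichain_def)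
  hence "min_gens N I = G" by (simp add: I min_gens_mono_ideal)
  thus "min_gens N I \<subseteq> monomials_in N" "I = mono_ideal N (min_gens N I)"
    using I G by simp_all
qed

subsection \<open>Borel ideals\<close>

definition set_mono :: "nat set \<Rightarrow> mono"
  where "set_mono V = (\<Sum>i\<in>V. Poly_Mapping.single i 1)"

lemma lookup_set_mono: "finite V \<Longrightarrow> Poly_Mapping.lookup (set_mono V) i = (if i \<in> V then 1 else 0)"
  by (simp add: set_mono_def lookup_sum lookup_single when_def)

lemma keys_set_mono [simp]: "finite V \<Longrightarrow> Poly_Mapping.keys (set_mono V) = V"
  by (auto simp: in_keys_iff lookup_set_mono split: if_splits)

lemma squarefree_set_mono: "finite V \<Longrightarrow> squarefree_mono (set_mono V)"
  by (simp add: squarefree_mono_def lookup_set_mono)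

lemma squarefree_eq_set_mono:
  assumes "squarefree_mono u"
  shows "u = set_mono (Poly_Mapping.keys u)"
proof (rule poly_mapping_eqI)
  fix i
  have "Poly_Mapping.lookup u i \<le> 1" using assms by (simp add: squarefree_mono_def)
  thus "Poly_Mapping.lookup u i = Poly_Mapping.lookup (set_mono (Poly_Mapping.keys u)) i"
    by (auto simp: lookup_set_mono in_keys_iff)
qed

lemma mono_deg_set_mono: "finite V \<Longrightarrow> mono_deg (set_mono V) = card V"
  by (simp add: mono_deg_def lookup_set_mono)

lemma set_mono_union: "finite V \<Longrightarrow> finite W \<Longrightarrow> V \<inter> W = {} \<Longrightarrow> set_mono (V \<union> W) = set_mono V + set_mono W"
  by (simp add: set_mono_def sum.union_disjoint)

lemma set_mono_exchange:
  assumes "finite V" "j \<in> V" "i \<notin> V"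
  shows "Poly_Mapping.single i 1 + (set_mono V - Poly_Mapping.single j 1) = set_mono (insert i (V - {j}))"
  using assms
  by (intro poly_mapping_eqI) (auto simp: lookup_add lookup_minus lookup_set_mono lookup_single when_def)

lemma set_mono_monomials_in: "finite V \<Longrightarrow> set_mono V \<in> monomials_in N \<longleftrightarrow> V \<subseteq> N"
  by (simp add: monomials_in_def)

lemma set_mono_multiples:
  assumes "finite V" "W \<subseteq> V" "V \<subseteq> N" "W \<in> B"
  shows "set_mono V \<in> multiples N (set_mono ` B)"
proof -
  have "set_mono V = set_mono W + set_mono (V - W)"
    using set_mono_union[of W "V - W"] assms by (simp add: finite_subset Un_absorb1)
  moreover have "set_mono (V - W) \<in> monomials_in N"
    using assms by (subst set_mono_monomials_in) auto
  ultimately show ?thesis using assms unfolding multiples_def by blast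
qed

definition borel_ideal :: "nat set \<Rightarrow> nat set \<Rightarrow> 'k::field mpoly set"
  where "borel_ideal N U = mono_ideal N (set_mono ` borel_set N U)"

lemma borel_set_monomials_in: "set_mono ` borel_set N U \<subseteq> monomials_in N"
  by (auto simp: borel_set_def set_mono_monomials_in)

text \<open>All these monomials have degree \<open>card U\<close>, so a cofactor between two of them
  has degree zero.\<close>

lemma antichain_borel_set: "antichain (set_mono ` borel_set N U)"
  unfolding antichain_def
proof (clarify)
  fix V W w assume *: "V \<in> borel_set N U" "W \<in> borel_set N U" "set_mono V = set_mono W + w"
  hence "card V = card W" "finite V" "finite W" by (auto simp: borel_set_def)
  hence "mono_deg (set_mono V) = mono_deg (set_mono W)" by (simp add: mono_deg_set_mono)
  thus "w = 0" using *(3) by (simp add: mono_deg_add mono_deg_eq_0_iff)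
qed

lemma min_gens_borel_ideal:
  "min_gens N (borel_ideal N U :: 'k::field mpoly set) = set_mono ` borel_set N U"
  unfolding borel_ideal_def
  by (rule min_gens_mono_ideal[OF borel_set_monomials_in antichain_borel_set])

lemma borel_ideal_stable: "squarefree_strongly_stable N (borel_ideal N U :: 'k::field mpoly set)"
  unfolding squarefree_strongly_stable_def
proof (intro conjI)
  show "monomial_ideal N (borel_ideal N U :: 'k mpoly set)"
    using borel_set_monomials_in unfolding monomial_ideal_iff borel_ideal_def by blast
  show "generated_in_single_degree N (borel_ideal N U :: 'k mpoly set)"
    unfolding generated_in_single_degree_def min_gens_borel_ideal
    by (auto simp: borel_set_def mono_deg_set_mono)
  show "\<forall>u\<in>min_gens N (borel_ideal N U :: 'k mpoly set). squarefree_mono u"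
    unfolding min_gens_borel_ideal by (auto simp: borel_set_def squarefree_set_mono)
  show "\<forall>u\<in>min_gens N (borel_ideal N U :: 'k mpoly set). \<forall>i\<in>N. \<forall>j\<in>N.
      i < j \<and> j \<in> Poly_Mapping.keys u \<and> i \<notin> Poly_Mapping.keys u \<longrightarrow>
      Poly_Mapping.single i 1 + (u - Poly_Mapping.single j 1) \<in> min_gens N (borel_ideal N U :: 'k mpoly set)"
    unfolding min_gens_borel_ideal
  proof clarify
    fix V i j
    assume V: "V \<in> borel_set N U" and ij: "i \<in> N" "i < j" "j \<in> Poly_Mapping.keys (set_mono V)"
      "i \<notin> Poly_Mapping.keys (set_mono V)"
    have "finite V" using V by (simp add: borel_set_def)
    thus "Poly_Mapping.single i 1 + (set_mono V - Poly_Mapping.single j 1) \<in> set_mono ` borel_set N U"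
      using V ij borel_set_exchange[of V N U i j] by (simp add: set_mono_exchange[simplified])
  qed
qed

text \<open>Membership of x_U in J does not make it a minimal generator of J; it only yields a
  minimal generator x_W of J with W contained in U, possibly of lower degree. The exchange argument
  is therefore run from W, and each generator of the Borel ideal of U is shown to be a multiple of
  one obtained from W.\<close>

lemma borel_ideal_smallest:
  assumes J: "squarefree_strongly_stable N (J :: 'k::field mpoly set)"
    and U: "finite U" "mono_poly (set_mono U) \<in> J"
  shows "borel_ideal N U \<subseteq> J"
proof -
  have "monomial_ideal N J" using J by (simp add: squarefree_strongly_stable_def)
  note G = monomial_ideal_obtain_min_gens[OF this]
  define \<G> where "\<G> = {W. finite W \<and> set_mono W \<in> min_gens N J}"
  have G_eq: "min_gens N J = set_mono ` \<G>"
  proof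
    show "min_gens N J \<subseteq> set_mono ` \<G>"
    proof
      fix u assume u: "u \<in> min_gens N J"
      hence "u = set_mono (Poly_Mapping.keys u)"
        using J by (intro squarefree_eq_set_mono) (simp add: squarefree_strongly_stable_def)
      thus "u \<in> set_mono ` \<G>" using u unfolding \<G>_def by (metis (mono_tags) finite_keys image_eqI mem_Collect_eq)
    qed
  qed (auto simp: \<G>_def)
  have stable: "insert i (W - {j}) \<in> \<G>" if "W \<in> \<G>" "i < j" "i \<in> N" "j \<in> W" "i \<notin> W" for W i j
  proof -
    have W: "finite W" "set_mono W \<in> min_gens N J" using that by (auto simp: \<G>_def)
    hence "W \<subseteq> N" using G(1) set_mono_monomials_in by blast
    hence "Poly_Mapping.single i 1 + (set_mono W - Poly_Mapping.single j 1) \<in> min_gens N J"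
      using J W that unfolding squarefree_strongly_stable_def by auto
    thus ?thesis using W that set_mono_exchange[of W j i] by (simp add: \<G>_def)
  qed
  have "set_mono U \<in> multiples N (min_gens N J)"
    using U(2) G(2) mono_poly_mem_mono_ideal_iff by blast
  then obtain W w where W: "W \<in> \<G>" "set_mono U = set_mono W + w"
    unfolding multiples_def G_eq by blast
  have "finite W" using W by (simp add: \<G>_def)
  have "W \<subseteq> U" using arg_cong[OF W(2), of Poly_Mapping.keys] U \<open>finite W\<close> by (auto simp: keys_add_nat)
  have "set_mono ` borel_set N U \<subseteq> multiples N (set_mono ` \<G>)"
  proof clarify
    fix V assume "V \<in> borel_set N U"
    hence V: "V \<subseteq> N" "finite V" "count_le U V" by (auto simp: borel_set_def)
    \<comment> \<open>Shrinking U to W only weakens the prefix conditions.\<close>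
    have "count_le W V" using V \<open>W \<subseteq> U\<close> U count_le_superset count_le_trans by blast
    then obtain V' where "V' \<in> borel_set N W" "V' \<subseteq> V"
      using count_le_borel_set[of V W N] V \<open>finite W\<close> by blast
    moreover have "V' \<in> \<G>"
      using borel_set_subset_stable[of \<G> N W] stable W(1) \<open>finite W\<close> calculation(1) by blast
    ultimately show "set_mono V \<in> multiples N (set_mono ` \<G>)"
      using V by (intro set_mono_multiples[of V V'])
  qed
  hence "borel_ideal N U \<subseteq> mono_ideal N (set_mono ` \<G>)"
    unfolding borel_ideal_def by (rule mono_ideal_mono)
  thus ?thesis using G(2) G_eq by simp
qed

lemma borel_ideal_generator:
  assumes "finite U" "U \<subseteq> N"
  shows "borel_generator N (set_mono U) (borel_ideal N U :: 'k::field mpoly set)"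
proof -
  have U: "U \<in> borel_set N U" using assms by (simp add: borel_set_def)
  hence "mono_poly (set_mono U) \<in> (borel_ideal N U :: 'k mpoly set)"
    by (auto simp: borel_ideal_def intro: multiples_self)
  thus ?thesis
    unfolding borel_generator_def min_gens_borel_ideal
    using U assms borel_ideal_stable[of N U] squarefree_set_mono borel_ideal_smallest by blast
qed

text \<open>Both ideals are stable, contain u and are least with these properties, so they
  coincide.\<close>

lemma borel_generator_eq_borel_ideal:
  assumes "borel_generator N u (I :: 'k::field mpoly set)"
  shows "\<exists>U. finite U \<and> U \<subseteq> N \<and> I = borel_ideal N U"
proof -
  define U where "U = Poly_Mapping.keys u"
  have u: "u = set_mono U" "finite U"
    using assms squarefree_eq_set_mono by (auto simp: borel_generator_def U_def)
  have "monomial_ideal N I" using assms by (simp add: borel_generator_def squarefree_strongly_stable_def)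
  hence "U \<subseteq> N"
    using assms monomial_ideal_obtain_min_gens(1)[of N I] set_mono_monomials_in[of U N] u
    by (auto simp: borel_generator_def)
  moreover have "borel_ideal N U \<subseteq> I"
    using assms u by (intro borel_ideal_smallest) (auto simp: borel_generator_def)
  moreover have "I \<subseteq> borel_ideal N U"
    using assms borel_ideal_generator[OF u(2) \<open>U \<subseteq> N\<close>, where 'k = 'k] u
    by (auto simp: borel_generator_def)
  ultimately show ?thesis using u by blast
qed

subsection \<open>Localization\<close>

definition denominators :: "nat \<Rightarrow> nat set \<Rightarrow> 'k::field mpoly set"
  where "denominators n A = carrier (poly_ring {1..n}) - mono_prime n A"

lemma multiples_singles:
  "k \<in> multiples N ((\<lambda>i. Poly_Mapping.single i 1) ` (N - A)) \<longleftrightarrow>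
    Poly_Mapping.keys k \<subseteq> N \<and> \<not> Poly_Mapping.keys k \<subseteq> A"
proof
  assume "k \<in> multiples N ((\<lambda>i. Poly_Mapping.single i 1) ` (N - A))"
  thus "Poly_Mapping.keys k \<subseteq> N \<and> \<not> Poly_Mapping.keys k \<subseteq> A"
    by (auto simp: multiples_def keys_add_nat monomials_in_def)
next
  assume k: "Poly_Mapping.keys k \<subseteq> N \<and> \<not> Poly_Mapping.keys k \<subseteq> A"
  then obtain i where i: "i \<in> Poly_Mapping.keys k" "i \<in> N - A" by blast
  define w where "w = k - Poly_Mapping.single i 1"
  have kw: "k = Poly_Mapping.single i 1 + w"
    using i by (intro poly_mapping_eqI) (auto simp: w_def lookup_add lookup_minus lookup_single when_def in_keys_iff)
  hence "w \<in> monomials_in N" using k by (auto simp: monomials_in_def keys_add_nat)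
  thus "k \<in> multiples N ((\<lambda>i. Poly_Mapping.single i 1) ` (N - A))"
    using kw i unfolding multiples_def by blast
qed

lemma mem_mono_prime_iff:
  "f \<in> mono_prime n A \<longleftrightarrow>
    (\<forall>k\<in>Poly_Mapping.keys f. Poly_Mapping.keys k \<subseteq> {1..n} \<and> \<not> Poly_Mapping.keys k \<subseteq> A)"
proof -
  have "mono_prime n A = mono_ideal {1..n} ((\<lambda>i. Poly_Mapping.single i 1) ` ({1..n} - A))"
    unfolding mono_prime_def
    by (subst Idl_mono_poly[symmetric]) (auto simp: var_def image_image monomials_in_def)
  thus ?thesis unfolding mono_ideal_def subset_iff[of _ "multiples _ _"] multiples_singles by auto
qed

lemma mem_denominators_iff:
  "g \<in> denominators n A \<longleftrightarrow>
    g \<in> carrier (poly_ring {1..n}) \<and> (\<exists>k\<in>Poly_Mapping.keys g. Poly_Mapping.keys k \<subseteq> A)"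
  unfolding denominators_def
  by (auto simp: mem_mono_prime_iff carrier_poly_ring monomials_in_def)

lemma poly_mapping_split:
  fixes f :: "'a \<Rightarrow>\<^sub>0 'b::comm_monoid_add"
  shows "\<exists>f1 f2. f = f1 + f2 \<and> Poly_Mapping.keys f1 = Poly_Mapping.keys f \<inter> X \<and>
    Poly_Mapping.keys f2 = Poly_Mapping.keys f - X"
proof -
  let ?r = "\<lambda>Y. \<Sum>k\<in>Y. Poly_Mapping.single k (Poly_Mapping.lookup f k)"
  have *: "Poly_Mapping.keys (?r Y) = Y" if "Y \<subseteq> Poly_Mapping.keys f" for Y
  proof -
    have "finite Y" using that finite_keys finite_subset by blast
    hence "Poly_Mapping.lookup (?r Y) i = (if i \<in> Y then Poly_Mapping.lookup f i else 0)" for i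
      by (simp add: lookup_sum lookup_single when_def)
    thus ?thesis using that by (auto simp: in_keys_iff split: if_splits)
  qed
  have "f = ?r (Poly_Mapping.keys f \<inter> X) + ?r (Poly_Mapping.keys f - X)"
    by (subst poly_mapping_sum_single[of f], subst sum.Int_Diff[of _ _ X]) auto
  thus ?thesis using * by (meson Diff_subset Int_lower1)
qed

text \<open>The product of two denominators is one since the parts of the factors involving only
  variables from \<open>A\<close> multiply to a nonzero polynomial.\<close>

lemma denominators_mult:
  fixes g h :: "'k::field mpoly"
  assumes "g \<in> denominators n A" "h \<in> denominators n A"
  shows "g * h \<in> denominators n A"
proof -
  let ?X = "{k :: mono. Poly_Mapping.keys k \<subseteq> A}"
  obtain g1 g2 where g: "g = g1 + g2" "Poly_Mapping.keys g1 = Poly_Mapping.keys g \<inter> ?X"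
    "Poly_Mapping.keys g2 = Poly_Mapping.keys g - ?X" using poly_mapping_split[of g ?X] by blast
  obtain h1 h2 where h: "h = h1 + h2" "Poly_Mapping.keys h1 = Poly_Mapping.keys h \<inter> ?X"
    "Poly_Mapping.keys h2 = Poly_Mapping.keys h - ?X" using poly_mapping_split[of h ?X] by blast
  have "g1 \<noteq> 0" "h1 \<noteq> 0" using assms g(2) h(2) by (auto simp: mem_denominators_iff)
  hence "g1 * h1 \<noteq> 0" by simp
  then obtain k where k: "k \<in> Poly_Mapping.keys (g1 * h1)"
    by (metis equals0I in_keys_iff lookup_zero poly_mapping_eqI)
  have kX: "k \<in> ?X" using k keys_mult[of g1 h1] g(2) h(2) by (fastforce simp: keys_add_nat)
  \<comment> \<open>Every monomial of this sum involves a variable outside A, whereas k does not;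
    hence the term at k cannot be cancelled.\<close>
  have "k \<notin> Poly_Mapping.keys (g1 * h2 + g2 * h)"
  proof
    assume "k \<in> Poly_Mapping.keys (g1 * h2 + g2 * h)"
    hence "k \<in> Poly_Mapping.keys (g1 * h2) \<or> k \<in> Poly_Mapping.keys (g2 * h)"
      using keys_add[of "g1 * h2" "g2 * h"] by blast
    thus False
    proof
      assume "k \<in> Poly_Mapping.keys (g1 * h2)"
      then obtain a b where "k = a + b" "b \<in> Poly_Mapping.keys h2" using keys_mult[of g1 h2] by auto
      thus False using kX h(3) by (auto simp: keys_add_nat)
    next
      assume "k \<in> Poly_Mapping.keys (g2 * h)"
      then obtain a b where "k = a + b" "a \<in> Poly_Mapping.keys g2" using keys_mult[of g2 h] by auto
      thus False using kX g(3) by (auto simp: keys_add_nat)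
    qed
  qed
  moreover have "g * h = g1 * h1 + (g1 * h2 + g2 * h)" using g h by (simp add: algebra_simps)
  ultimately have "k \<in> Poly_Mapping.keys (g * h)" using k by (simp add: in_keys_iff lookup_add)
  moreover have "g * h \<in> carrier (poly_ring {1..n})"
    using assms poly_ring_closed(4)[of g "{1..n}" h] by (simp add: mem_denominators_iff)
  ultimately show ?thesis using kX by (auto simp: mem_denominators_iff)
qed

lemma denominators_nonzero: "g \<in> denominators n A \<Longrightarrow> g \<noteq> 0"
  by (auto simp: mem_denominators_iff)

lemma one_denominators: "1 \<in> denominators n A"
  by (auto simp: mem_denominators_iff carrier_poly_ring)

lemma mono_poly_denominators: "Poly_Mapping.keys m \<subseteq> A \<Longrightarrow> A \<subseteq> {1..n} \<Longrightarrow> mono_poly m \<in> denominators n A"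
  by (auto simp: mem_denominators_iff carrier_poly_ring monomials_in_def)

text \<open>For an ideal I of S, common denominators make this set closed under addition, so single
  fractions replace finite sums of fractions in the extended ideal. With I = S it is the carrier of
  the local ring.\<close>

definition fracs :: "nat \<Rightarrow> nat set \<Rightarrow> 'k::field mpoly set \<Rightarrow> 'k mpoly fract set"
  where "fracs n A I = {Fract f g | f g. f \<in> I \<and> g \<in> denominators n A}"

lemma local_ring_eq: "local_ring n A = ring_on (fracs n A (carrier (poly_ring {1..n})))"
  by (simp add: local_ring_def fracs_def denominators_def)

lemma fracs_mult:
  assumes "x \<in> fracs n A I" "y \<in> fracs n A (carrier (poly_ring {1..n}))"
    and "\<And>p q. p \<in> I \<Longrightarrow> q \<in> carrier (poly_ring {1..n}) \<Longrightarrow> q * p \<in> I"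
  shows "y * x \<in> fracs n A I"
proof -
  obtain f g where x: "x = Fract f g" "f \<in> I" "g \<in> denominators n A" using assms(1) by (auto simp: fracs_def)
  obtain p q where y: "y = Fract p q" "p \<in> carrier (poly_ring {1..n})" "q \<in> denominators n A"
    using assms(2) by (auto simp: fracs_def)
  have "y * x = Fract (p * f) (q * g)" by (simp add: x y)
  thus ?thesis using x y assms(3) denominators_mult unfolding fracs_def by blast
qed

lemma fracs_add:
  assumes "x \<in> fracs n A I" "y \<in> fracs n A I"
    and "\<And>p q. p \<in> I \<Longrightarrow> q \<in> carrier (poly_ring {1..n}) \<Longrightarrow> p * q \<in> I"
    and "\<And>p q. p \<in> I \<Longrightarrow> q \<in> I \<Longrightarrow> p + q \<in> I"
  shows "x + y \<in> fracs n A I"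
proof -
  obtain f g where x: "x = Fract f g" "f \<in> I" "g \<in> denominators n A" using assms(1) by (auto simp: fracs_def)
  obtain p q where y: "y = Fract p q" "p \<in> I" "q \<in> denominators n A"
    using assms(2) by (auto simp: fracs_def)
  have "x + y = Fract (f * q + p * g) (g * q)"
    using denominators_nonzero[OF x(3)] denominators_nonzero[OF y(3)] by (simp add: x y)
  moreover have "f * q + p * g \<in> I" using assms x y by (simp add: mem_denominators_iff)
  ultimately show ?thesis using x y denominators_mult unfolding fracs_def by blast
qed

lemma fracs_one: "f \<in> I \<Longrightarrow> Fract f 1 \<in> fracs n A I"
  using one_denominators unfolding fracs_def by blast

lemma ring_local_ring: "ring (local_ring n A :: 'k::field mpoly fract ring)"
  unfolding local_ring_eq
proof (rule ring_of_closed)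
  show "0 \<in> fracs n A (carrier (poly_ring {1..n} :: 'k mpoly ring))"
    "1 \<in> fracs n A (carrier (poly_ring {1..n} :: 'k mpoly ring))"
    unfolding Zero_fract_def One_fract_def by (intro fracs_one poly_ring_closed)+
  fix x y :: "'k mpoly fract"
  assume x: "x \<in> fracs n A (carrier (poly_ring {1..n}))"
  then obtain f g where fg: "x = Fract f g" "f \<in> carrier (poly_ring {1..n})" "g \<in> denominators n A"
    by (auto simp: fracs_def)
  have "- x = Fract (- f) g" by (simp add: fg)
  moreover have "- f \<in> carrier (poly_ring {1..n})" by (intro poly_ring_closed fg)
  ultimately show "- x \<in> fracs n A (carrier (poly_ring {1..n}))" using fg by (auto simp: fracs_def)
  assume y: "y \<in> fracs n A (carrier (poly_ring {1..n}))"
  show "x + y \<in> fracs n A (carrier (poly_ring {1..n}))" by (intro fracs_add x y poly_ring_closed)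
  show "x * y \<in> fracs n A (carrier (poly_ring {1..n}))" by (intro fracs_mult x y poly_ring_closed)
qed

lemma mono_ideal_subset_carrier:
  "N' \<subseteq> N \<Longrightarrow> U \<subseteq> monomials_in N' \<Longrightarrow> (mono_ideal N' U :: 'k::field mpoly set) \<subseteq> carrier (poly_ring N)"
  using multiples_subset_monomials_in[of U N'] by (fastforce simp: mono_ideal_def carrier_poly_ring monomials_in_def)

lemma ideal_fracs:
  assumes "U \<subseteq> monomials_in {1..n}"
  shows "ideal (fracs n A (mono_ideal {1..n} U)) (local_ring n A :: 'k::field mpoly fract ring)"
  unfolding local_ring_eq
proof (rule ideal_of_closed)
  show "ring (ring_on (fracs n A (carrier (poly_ring {1..n} :: 'k mpoly ring))))"
    using ring_local_ring by (metis local_ring_eq)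
  show "fracs n A (mono_ideal {1..n} U) \<subseteq> fracs n A (carrier (poly_ring {1..n} :: 'k mpoly ring))"
    using mono_ideal_subset_carrier[OF order_refl assms] unfolding fracs_def by blast
  show "0 \<in> fracs n A (mono_ideal {1..n} U :: 'k mpoly set)"
    unfolding Zero_fract_def by (rule fracs_one) simp
  fix x y :: "'k mpoly fract"
  assume x: "x \<in> fracs n A (mono_ideal {1..n} U)"
  show "x + y \<in> fracs n A (mono_ideal {1..n} U)" if "y \<in> fracs n A (mono_ideal {1..n} U)"
    using mono_ideal_mult by (intro fracs_add x that mono_ideal_add) (auto simp: mult.commute)
  show "y * x \<in> fracs n A (mono_ideal {1..n} U)" if "y \<in> fracs n A (carrier (poly_ring {1..n}))"
    by (intro fracs_mult x that mono_ideal_mult)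
qed

section \<open>Comparing the extensions of monomial ideals\<close>

lemma multiples_ring_mono: "N' \<subseteq> N \<Longrightarrow> multiples N' U \<subseteq> multiples N U"
  unfolding multiples_def monomials_in_def by blast

lemma mono_ideal_ring_mono: "N' \<subseteq> N \<Longrightarrow> mono_ideal N' U \<subseteq> mono_ideal N U"
  using multiples_ring_mono[of N' N U] by (auto simp: mono_ideal_def)

lemma ideal_local_extension:
  assumes "I \<subseteq> carrier (poly_ring {1..n})"
  shows "ideal (local_extension n A I) (local_ring n A :: 'k::field mpoly fract ring)"
    and "f \<in> I \<Longrightarrow> Fract f 1 \<in> local_extension n A I"
proof -
  interpret ring "local_ring n A :: 'k mpoly fract ring" by (rule ring_local_ring)
  have sub: "(\<lambda>f. Fract f 1) ` I \<subseteq> carrier (local_ring n A :: 'k mpoly fract ring)"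
    using assms by (auto simp: local_ring_eq intro!: fracs_one)
  show "ideal (local_extension n A I) (local_ring n A)"
    unfolding local_extension_def by (rule genideal_ideal[OF sub])
  show "f \<in> I \<Longrightarrow> Fract f 1 \<in> local_extension n A I"
    unfolding local_extension_def using genideal_self[OF sub] by blast
qed

text \<open>This bound turns membership in an extension into an equation between a fraction and a
  quotient f/g, with f in the monomial ideal of S on the same generators.\<close>

lemma local_extension_subset_fracs:
  assumes "N' \<subseteq> {1..n}" "U \<subseteq> monomials_in N'"
  shows "local_extension n A (mono_ideal N' U :: 'k::field mpoly set) \<subseteq> fracs n A (mono_ideal {1..n} U)"
proof -
  interpret ring "local_ring n A :: 'k mpoly fract ring" by (rule ring_local_ring)
  have "U \<subseteq> monomials_in {1..n}" using assms by (auto simp: monomials_in_def)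
  thus ?thesis
    unfolding local_extension_def
    using mono_ideal_ring_mono[OF assms(1)] fracs_one by (intro genideal_minimal ideal_fracs) blast+
qed

text \<open>A monomial m in the variables of A is a unit in the local ring, so the hypothesis
  expresses u as v times w/m. The rings of the two ideals may differ, which allows comparing an
  ideal of S with one of S_A in either direction.\<close>

lemma local_extension_mono_ideal_subset:
  assumes N: "N1 \<subseteq> {1..n}" "N2 \<subseteq> {1..n}" "A \<subseteq> {1..n}"
    and U: "U1 \<subseteq> monomials_in N1" "U2 \<subseteq> monomials_in N2"
    and div: "\<And>u. u \<in> U1 \<Longrightarrow> \<exists>m v w. Poly_Mapping.keys m \<subseteq> A \<and> u + m = v + w \<and> v \<in> U2 \<and> w \<in> monomials_in {1..n}"
  shows "local_extension n A (mono_ideal N1 U1 :: 'k::field mpoly set) \<subseteq> local_extension n A (mono_ideal N2 U2)"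
proof -
  interpret ring "local_ring n A :: 'k mpoly fract ring" by (rule ring_local_ring)
  let ?L = "local_extension n A (mono_ideal N2 U2) :: 'k mpoly fract set"
  note sub = mono_ideal_subset_carrier[OF N(2) U(2), where 'k = 'k]
  interpret L: ideal ?L "local_ring n A" by (rule ideal_local_extension(1)[OF sub])
  have mult: "Fract f g * x \<in> ?L" if "x \<in> ?L" "f \<in> carrier (poly_ring {1..n})" "g \<in> denominators n A" for f g x
  proof -
    have "Fract f g \<in> carrier (local_ring n A)" using that by (auto simp: local_ring_eq fracs_def)
    from L.I_l_closed[OF that(1) this] show ?thesis by (simp add: local_ring_eq)
  qed
  have gen: "Fract (mono_poly u) 1 \<in> ?L" if "u \<in> U1" for u
  proof -
    obtain m v w where m: "Poly_Mapping.keys m \<subseteq> A" "u + m = v + w" "v \<in> U2" "w \<in> monomials_in {1..n}"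
      using div[OF \<open>u \<in> U1\<close>] by blast
    have "mono_poly v \<in> (mono_ideal N2 U2 :: 'k mpoly set)" using m by (auto intro: multiples_self)
    hence "Fract (mono_poly v) 1 \<in> ?L" by (rule ideal_local_extension(2)[OF sub])
    hence "Fract (mono_poly w) (mono_poly m) * Fract (mono_poly v) 1 \<in> ?L"
      using m N by (intro mult mono_poly_denominators) (auto simp: carrier_poly_ring)
    also have "Fract (mono_poly w) (mono_poly m) * Fract (mono_poly v) 1 = Fract (mono_poly u :: 'k mpoly) 1"
      using m(2) by (simp add: eq_fract add.commute flip: mono_poly_add)
    finally show ?thesis .
  qed
  have "Fract f 1 \<in> ?L" if f: "f \<in> mono_ideal N1 U1" for f
  proof -
    \<comment> \<open>This set of polynomials is closed under addition, so it is enough to treat the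
      single terms of f.\<close>
    have "f \<in> {f. Fract f 1 \<in> ?L}"
    proof (rule poly_mapping_closed)
      show "0 \<in> {f. Fract f 1 \<in> ?L}" using L.zero_closed by (simp add: local_ring_eq flip: Zero_fract_def)
      show "x + y \<in> {f. Fract f 1 \<in> ?L}" if "x \<in> {f. Fract f 1 \<in> ?L}" "y \<in> {f. Fract f 1 \<in> ?L}" for x y
        using that L.a_closed[of "Fract x 1" "Fract y 1"] by (simp add: local_ring_eq)
    next
      fix k and c :: 'k assume "k \<in> Poly_Mapping.keys f"
      then obtain u w where k: "k = u + w" "u \<in> U1" "w \<in> monomials_in N1"
        using f by (auto simp: mono_ideal_def multiples_def)
      have "Fract (Poly_Mapping.single w c) 1 * Fract (mono_poly u) 1 \<in> ?L"
        using k N by (intro mult gen one_denominators) (auto simp: carrier_poly_ring monomials_in_def)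
      thus "Poly_Mapping.single k c \<in> {f. Fract f 1 \<in> ?L}"
        by (simp add: mono_poly_def mult_single k add.commute)
    qed
    thus ?thesis by simp
  qed
  thus ?thesis
    unfolding local_extension_def[of n A "mono_ideal N1 U1"]
    by (intro genideal_minimal L.is_ideal) blast
qed

lemma keys_mult_mono_poly:
  fixes g :: "'k::field mpoly"
  assumes "k \<in> Poly_Mapping.keys g"
  shows "k + u \<in> Poly_Mapping.keys (g * mono_poly u)"
proof -
  have "Poly_Mapping.lookup (g * mono_poly u) (k + u) = Poly_Mapping.lookup g k"
  proof -
    \<comment> \<open>The coefficient of a product is a double sum. The factor
      \<open>mono_poly u\<close> fixes q = u in the inner sum, and cancelling u from k + u = l + u
      leaves only l = k, so the shift by u causes no cancellation.\<close>
    have "(\<lambda>q. (1 :: 'k) when u = q when k + u = l + q) = (\<lambda>q. (1 when k = l) when u = q)" for l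
      by (auto simp: when_def fun_eq_iff)
    from arg_cong[OF this, of Sum_any] have "(\<Sum>q. (1 :: 'k) when u = q when k + u = l + q) = (1 when k = l)" for l
      by simp
    thus ?thesis by (simp add: lookup_mult mono_poly_def lookup_single mult_when)
  qed
  thus ?thesis using assms by (simp add: in_keys_iff)
qed

text \<open>If u = f/g in the local ring, then g u = f. The denominator g has a monomial k in the
  variables of A alone, so k u is a monomial of f and hence a multiple of some v in V. As v has no
  variable from A, it divides u already.\<close>

lemma mono_ideal_subset_of_local_extension:
  assumes U: "U \<subseteq> monomials_in ({1..n} - A)" "V \<subseteq> monomials_in ({1..n} - A)"
    and sub: "local_extension n A (mono_ideal ({1..n} - A) U :: 'k::field mpoly set)
      \<subseteq> local_extension n A (mono_ideal ({1..n} - A) V)"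
  shows "mono_ideal ({1..n} - A) U \<subseteq> (mono_ideal ({1..n} - A) V :: 'k mpoly set)"
proof (rule mono_ideal_mono, rule subsetI)
  fix u assume u: "u \<in> U"
  have "mono_poly u \<in> (mono_ideal ({1..n} - A) U :: 'k mpoly set)" using u by (auto intro: multiples_self)
  hence "Fract (mono_poly u :: 'k mpoly) 1 \<in> local_extension n A (mono_ideal ({1..n} - A) U)"
    by (rule ideal_local_extension(2)[OF mono_ideal_subset_carrier[OF Diff_subset U(1)]])
  hence "Fract (mono_poly u :: 'k mpoly) 1 \<in> fracs n A (mono_ideal {1..n} V)"
    using sub local_extension_subset_fracs[of "{1..n} - A" n V A, OF _ U(2)] by blast
  then obtain f g where fg: "Fract (mono_poly u :: 'k mpoly) 1 = Fract f g"
    "f \<in> mono_ideal {1..n} V" "g \<in> denominators n A" unfolding fracs_def by blast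
  have "g * mono_poly u = f"
    using fg(1) denominators_nonzero[OF fg(3)] by (simp add: eq_fract mult.commute)
  obtain k where k: "k \<in> Poly_Mapping.keys g" "Poly_Mapping.keys k \<subseteq> A"
    using fg(3) by (auto simp: mem_denominators_iff)
  have "k + u \<in> multiples {1..n} V"
    using keys_mult_mono_poly[OF k(1), of u] \<open>g * mono_poly u = f\<close> fg(2) by (auto simp: mono_ideal_def)
  then obtain v w where v: "k + u = v + w" "v \<in> V" by (auto simp: multiples_def)
  have v0: "Poly_Mapping.lookup v i = 0" if "i \<in> A" for i
    using v(2) U(2) that by (auto simp: monomials_in_def in_keys_iff subset_iff)
  have k0: "Poly_Mapping.lookup k i = 0" if "i \<notin> A" for i
    using k(2) that by (auto simp: in_keys_iff subset_iff)
  \<comment> \<open>At an index in A the exponent of v is zero; at any other index k contributes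
    nothing to k + u = v + w.\<close>
  have le: "Poly_Mapping.lookup v i \<le> Poly_Mapping.lookup u i" for i
    using arg_cong[OF v(1), of "\<lambda>m. Poly_Mapping.lookup m i"] v0[of i] k0[of i]
    by (cases "i \<in> A") (auto simp: lookup_add)
  have uv: "u = v + (u - v)" using le by (intro poly_mapping_eqI) (simp add: lookup_add lookup_minus)
  moreover have "u - v \<in> monomials_in ({1..n} - A)" using u U(1) uv by (metis monomials_in_add subsetD)
  ultimately show "u \<in> multiples ({1..n} - A) V" using v(2) unfolding multiples_def by blast
qed

subsection \<open>Localization of Borel ideals\<close>

text \<open>Up to units, a generator x_W of either ideal has to be a multiple of a generator of the
  other. From S_A to S, multiplying x_W by the product of the variables of A makes the condition for
  U available; from S to S_A, the part of W outside A already satisfies the condition for V.\<close>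

lemma local_extension_borel_ideal:
  assumes "A \<subseteq> {1..n}" "U \<subseteq> {1..n}" "V \<subseteq> {1..n} - A"
    and V: "\<And>W. finite W \<Longrightarrow> W \<inter> A = {} \<Longrightarrow> count_le U (W \<union> A) \<longleftrightarrow> count_le V W"
  shows "local_extension n A (borel_ideal ({1..n} - A) V :: 'k::field mpoly set) =
    local_extension n A (borel_ideal {1..n} U)"
proof
  have fin: "finite A" "finite U" "finite V" using assms(1-3) by (auto intro: finite_subset)
  show "local_extension n A (borel_ideal ({1..n} - A) V :: 'k mpoly set) \<subseteq>
      local_extension n A (borel_ideal {1..n} U)"
    unfolding borel_ideal_def
  proof (rule local_extension_mono_ideal_subset[OF Diff_subset order_refl assms(1)
        borel_set_monomials_in borel_set_monomials_in])
    fix u assume "u \<in> set_mono ` borel_set ({1..n} - A) V"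
    then obtain W where W: "u = set_mono W" "W \<subseteq> {1..n} - A" "finite W" "count_le V W"
      by (auto simp: borel_set_def)
    have "W \<inter> A = {}" using W by blast
    hence "count_le U (W \<union> A)" using V W by blast
    then obtain W' where "W' \<in> borel_set {1..n} U" "W' \<subseteq> W \<union> A"
      using count_le_borel_set[of "W \<union> A" U "{1..n}"] W fin assms(1) by blast
    hence "set_mono (W \<union> A) \<in> multiples {1..n} (set_mono ` borel_set {1..n} U)"
      using W fin assms(1) by (intro set_mono_multiples[of _ W']) auto
    then obtain v w where "set_mono (W \<union> A) = v + w" "v \<in> set_mono ` borel_set {1..n} U"
      "w \<in> monomials_in {1..n}" unfolding multiples_def by blast
    \<comment> \<open>The unit multiplier m is the product of all variables of A.\<close>
    moreover have "set_mono (W \<union> A) = u + set_mono A"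
      using W fin \<open>W \<inter> A = {}\<close> by (simp add: set_mono_union)
    moreover have "Poly_Mapping.keys (set_mono A) \<subseteq> A" using fin by simp
    ultimately show "\<exists>m v w. Poly_Mapping.keys m \<subseteq> A \<and> u + m = v + w \<and>
        v \<in> set_mono ` borel_set {1..n} U \<and> w \<in> monomials_in {1..n}" by metis
  qed
  show "local_extension n A (borel_ideal {1..n} U :: 'k mpoly set) \<subseteq>
      local_extension n A (borel_ideal ({1..n} - A) V)"
    unfolding borel_ideal_def
  proof (rule local_extension_mono_ideal_subset[OF order_refl Diff_subset assms(1)
        borel_set_monomials_in borel_set_monomials_in])
    fix u assume "u \<in> set_mono ` borel_set {1..n} U"
    then obtain W where W: "u = set_mono W" "W \<subseteq> {1..n}" "finite W" "count_le U W"
      by (auto simp: borel_set_def)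
    \<comment> \<open>The hypothesis on V concerns sets disjoint from A, so W is split into
      \<open>W - A\<close> and A; filling up to all of A only raises the counts.\<close>
    have "count_le W ((W - A) \<union> A)" using W fin by (intro count_le_superset) auto
    hence "count_le U ((W - A) \<union> A)" using W count_le_trans by blast
    hence "count_le V (W - A)" using V[of "W - A"] W by blast
    then obtain W' where W': "W' \<in> borel_set ({1..n} - A) V" "W' \<subseteq> W - A"
      using count_le_borel_set[of "W - A" V "{1..n} - A"] W fin by blast
    have "W' \<union> (W - W') = W" "finite W'" using W W' by (auto intro: finite_subset)
    hence "u = set_mono W' + set_mono (W - W')"
      using set_mono_union[of W' "W - W'"] W by simp
    moreover have "set_mono (W - W') \<in> monomials_in {1..n}"
      using W by (subst set_mono_monomials_in) auto
    \<comment> \<open>No unit has to be multiplied in here: m is the monomial 1, with exponent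
      vector 0.\<close>
    moreover have "Poly_Mapping.keys (0 :: mono) \<subseteq> A" by simp
    ultimately show "\<exists>m v w. Poly_Mapping.keys m \<subseteq> A \<and> u + m = v + w \<and>
        v \<in> set_mono ` borel_set ({1..n} - A) V \<and> w \<in> monomials_in {1..n}"
      using W'(1) by (metis add.right_neutral image_eqI)
  qed
qed

text \<open>Equal extensions force equal monomial ideals of S_A, so a single candidate with the
  right extension determines the definite description.\<close>

lemma monomial_localization_eqI:
  assumes J: "monomial_ideal ({1..n} - A) (J :: 'k::field mpoly set)"
    and eq: "local_extension n A J = local_extension n A I"
  shows "monomial_localization n A I = J"
  unfolding monomial_localization_def
proof (rule the_equality)
  show "monomial_ideal ({1..n} - A) J \<and> local_extension n A J = local_extension n A I"
    by (intro conjI J eq)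
next
  fix J' :: "'k mpoly set"
  assume J': "monomial_ideal ({1..n} - A) J' \<and> local_extension n A J' = local_extension n A I"
  obtain U U' where U: "U \<subseteq> monomials_in ({1..n} - A)" "J = mono_ideal ({1..n} - A) U"
    and U': "U' \<subseteq> monomials_in ({1..n} - A)" "J' = mono_ideal ({1..n} - A) U'"
    using J conjunct1[OF J'] unfolding monomial_ideal_iff by blast
  have eq': "local_extension n A J = local_extension n A J'" by (rule trans[OF eq sym[OF conjunct2[OF J']]])
  show "J' = J"
  proof
    show "J' \<subseteq> J"
      using mono_ideal_subset_of_local_extension[OF U'(1) U(1), where 'k = 'k] eq'
      unfolding U(2) U'(2) by blast
    show "J \<subseteq> J'"
      using mono_ideal_subset_of_local_extension[OF U(1) U'(1), where 'k = 'k] eq'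
      unfolding U(2) U'(2) by blast
  qed
qed

theorem theorem1p2:
  fixes n :: nat and A :: "nat set" and I :: "'k::field mpoly set"
  assumes "squarefree_strongly_stable_principal {1..n} I"
    and "A \<subseteq> {1..n}"
  shows "squarefree_strongly_stable_principal ({1..n} - A) (monomial_localization n A I)"
proof -
  obtain U where U: "U \<subseteq> {1..n}" "I = borel_ideal {1..n} U"
    using assms(1) borel_generator_eq_borel_ideal
    unfolding squarefree_strongly_stable_principal_def by blast
  have "finite A" using assms(2) finite_subset by blast
  from count_le_union_iff[OF this, of U] obtain V where V: "V \<subseteq> U - A"
    "\<And>W. finite W \<Longrightarrow> W \<inter> A = {} \<Longrightarrow> count_le U (W \<union> A) \<longleftrightarrow> count_le V W"
    by blast
  \<comment> \<open>As V avoids A, x_V is a monomial of S_A and can serve as its Borel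
    generator.\<close>
  have VN: "V \<subseteq> {1..n} - A" using U V by blast
  have gen: "borel_generator ({1..n} - A) (set_mono V) (borel_ideal ({1..n} - A) V :: 'k mpoly set)"
    using VN by (intro borel_ideal_generator) (auto intro: finite_subset)
  have "monomial_localization n A I = borel_ideal ({1..n} - A) V"
  proof (rule monomial_localization_eqI)
    show "monomial_ideal ({1..n} - A) (borel_ideal ({1..n} - A) V :: 'k mpoly set)"
      using borel_ideal_stable by (auto simp: squarefree_strongly_stable_def)
    show "local_extension n A (borel_ideal ({1..n} - A) V) = local_extension n A I"
      unfolding U(2) by (rule local_extension_borel_ideal[OF assms(2) U(1) VN V(2)])
  qed
  thus ?thesis using gen unfolding squarefree_strongly_stable_principal_def by metis
qed

end
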